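(* Let $T$ be a tree of order $p\ge 3$. Then $\gamma_{[3R]}(T)=\frac{7p}{4}$ if and only if $T\in\mathcal{F}$.
   Context: $\mathcal{F}$ is the family of all trees obtained as follows: take $k\ge 1$ vertex-disjoint paths $P_4^i: v_1^iv_2^iv_3^iv_4^i$ ($1\le i\le k$) and add $k-1$ edges, each joining two of the vertices $v_2^1,\dots,v_2^k$, so that the subgraph induced by $\{v_2^1,\dots,v_2^k\}$ is connected. For a graph $\Gamma=(V,E)$ and $h:V\to\{0,1,2,3,4\}$, let $AN(v)=\{w\in N(v):h(w)\ge 1\}$, $AN[v]=AN(v)\cup\{v\}$ and $h(S)=\sum_{u\in S}h(u)$. $h$ is a triple Roman dominating function (3RDF) if every $v$ with $h(v)<3$ satisfies $h(AN[v])\ge|AN(v)|+3$. The triple Roman domination number $\gamma_{[3R]}(\Gamma)$ is the minimum weight $h(V)$ of a 3RDF of $\Gamma$. *)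

theory Defs
  imports Complex_Main
begin

text \<open>Finite simple graphs: vertex set V, edges E given as 2-element sets of vertices.\<close>

definition simple_graph :: "'a set \<Rightarrow> 'a set set \<Rightarrow> bool" where
  "simple_graph V E \<longleftrightarrow> finite V \<and>
     (\<forall>e\<in>E. \<exists>u w. e = {u, w} \<and> u \<noteq> w \<and> u \<in> V \<and> w \<in> V)"

definition adj_rel :: "'a set set \<Rightarrow> ('a \<times> 'a) set" where
  "adj_rel E = {(x, y). {x, y} \<in> E}"

definition connected_graph :: "'a set \<Rightarrow> 'a set set \<Rightarrow> bool" where
  "connected_graph V E \<longleftrightarrow> (\<forall>u\<in>V. \<forall>w\<in>V. (u, w) \<in> (adj_rel E)\<^sup>*)"

text \<open>A cycle: a list of at least 3 distinct vertices, consecutive ones adjacent,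
  and the last adjacent to the first.\<close>
definition is_cycle :: "'a set set \<Rightarrow> 'a list \<Rightarrow> bool" where
  "is_cycle E xs \<longleftrightarrow> distinct xs \<and> length xs \<ge> 3 \<and>
     (\<forall>i. i + 1 < length xs \<longrightarrow> {xs ! i, xs ! (i + 1)} \<in> E) \<and>
     {last xs, hd xs} \<in> E"

definition is_tree :: "'a set \<Rightarrow> 'a set set \<Rightarrow> bool" where
  "is_tree V E \<longleftrightarrow> simple_graph V E \<and> V \<noteq> {} \<and> connected_graph V E \<and>
     \<not> (\<exists>xs. is_cycle E xs)"

definition nbhd :: "'a set set \<Rightarrow> 'a \<Rightarrow> 'a set" where
  "nbhd E v = {w. {v, w} \<in> E}"

text \<open>Active neighbourhood AN(v) and closed active neighbourhood AN[v].\<close>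
definition AN :: "'a set set \<Rightarrow> ('a \<Rightarrow> nat) \<Rightarrow> 'a \<Rightarrow> 'a set" where
  "AN E h v = {w \<in> nbhd E v. h w \<ge> 1}"

definition ANc :: "'a set set \<Rightarrow> ('a \<Rightarrow> nat) \<Rightarrow> 'a \<Rightarrow> 'a set" where
  "ANc E h v = insert v (AN E h v)"

definition is_3RDF :: "'a set \<Rightarrow> 'a set set \<Rightarrow> ('a \<Rightarrow> nat) \<Rightarrow> bool" where
  "is_3RDF V E h \<longleftrightarrow> (\<forall>v\<in>V. h v \<le> 4) \<and>
     (\<forall>v\<in>V. h v < 3 \<longrightarrow> sum h (ANc E h v) \<ge> card (AN E h v) + 3)"

definition gamma3R :: "'a set \<Rightarrow> 'a set set \<Rightarrow> nat" where
  "gamma3R V E = (LEAST w. \<exists>h. is_3RDF V E h \<and> w = sum h V)"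

text \<open>The family F: k \<ge> 1 disjoint paths v(i,1) v(i,2) v(i,3) v(i,4), plus k-1 edges among
  the vertices v(i,2) such that the subgraph induced by them is connected.\<close>
definition in_family_F :: "'a set \<Rightarrow> 'a set set \<Rightarrow> bool" where
  "in_family_F V E \<longleftrightarrow> (\<exists>(k::nat) (v :: nat \<times> nat \<Rightarrow> 'a) S.
     k \<ge> 1 \<and>
     inj_on v ({..<k} \<times> {1..4}) \<and>
     V = v ` ({..<k} \<times> {1..4}) \<and>
     S \<subseteq> {{v (i, 2), v (j, 2)} | i j. i < k \<and> j < k \<and> i \<noteq> j} \<and>
     card S = k - 1 \<and>
     connected_graph (v ` ({..<k} \<times> {2})) S \<and>
     E = {{v (i, j), v (i, j + 1)} | i j. i < k \<and> 1 \<le> j \<and> j \<le> 3} \<union> S)"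

end

theory Submission
  imports Defs
begin

text \<open>
  A vertex \<open>v\<close> is fine when \<open>h v \<ge> 3\<close> or the excesses \<open>h w - 1\<close> of its active neighbours sum up
  to at least \<open>3 - h v\<close>; in particular adding edges preserves triple Roman domination, so labellings
  of vertex-disjoint subtrees can be put side by side. A tree of order at least 3 either has an edge
  whose removal leaves two trees of order at least 3, or it is a spider with legs of length at most 2.
  An explicit labelling of a spider weighs less than \<open>7p/4\<close> unless the spider is \<open>P\<^sub>4\<close>. In the other
  case, induction leaves only two members of the family joined by an edge \<open>xy\<close>. If \<open>x\<close> and \<open>y\<close> are
  both backbone vertices (of type \<open>v\<^sub>2\<close>), the result is again in the family. Otherwise one side saves
  weight by leaving its end of \<open>xy\<close> to be dominated by a label 4 at the other end: the saving is 3 at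
  a leaf and 1 at a vertex \<open>v\<^sub>3\<close>, while forcing a label 4 costs at most 1 extra, and only at a leaf.
  Conversely, a triple Roman dominating function has weight at least 7 on each of the paths.
\<close>

section \<open>Dominating labellings\<close>

text \<open>Sufficient for the 3RDF inequality but not equivalent to it: label 2 next to another
  label 2 satisfies the inequality as well. Only the patterns that the explicit labellings use are
  listed, so that checking them stays a matter of finding one or two neighbours.\<close>

definition dominated :: "'a set set \<Rightarrow> ('a \<Rightarrow> nat) \<Rightarrow> 'a \<Rightarrow> bool" where
  "dominated E h v \<longleftrightarrow> h v \<ge> 3 \<or> (\<exists>w. {v, w} \<in> E \<and> h w = 4) \<or>
     (\<exists>w w'. w \<noteq> w' \<and> {v, w} \<in> E \<and> {v, w'} \<in> E \<and> h w = 3 \<and> h w' = 3)"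

lemma dominated_self: "h v \<ge> 3 \<Longrightarrow> dominated E h v"
  unfolding dominated_def by blast

lemma dominated_neighbour: "{v, w} \<in> E \<Longrightarrow> h w = 4 \<Longrightarrow> dominated E h v"
  unfolding dominated_def by blast

lemma simple_graph_edge:
  assumes "simple_graph V E" "{u, w} \<in> E"
  shows "u \<in> V" "w \<in> V" "u \<noteq> w"
  using assms unfolding simple_graph_def by (auto simp: doubleton_eq_iff)+

lemma simple_graph_mono:
  assumes "simple_graph V E" "E' \<subseteq> E" "\<And>e. e \<in> E' \<Longrightarrow> e \<subseteq> V'" "finite V'"
  shows "simple_graph V' E'"
  unfolding simple_graph_def
proof (intro conjI ballI)
  fix e assume e: "e \<in> E'"
  then obtain u w where "e = {u, w}" "u \<noteq> w"
    using assms(1,2) unfolding simple_graph_def by blast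
  then show "\<exists>u w. e = {u, w} \<and> u \<noteq> w \<and> u \<in> V' \<and> w \<in> V'"
    using assms(3)[OF e] by auto
qed (fact assms(4))

text \<open>Neighbours along \<open>E\<close> lie in \<open>V\<close>, where both labellings agree,
  so every witness survives; further edges only offer more witnesses.\<close>

lemma dominated_mono:
  assumes "simple_graph V E" "E \<subseteq> E'" "v \<in> V" "\<And>u. u \<in> V \<Longrightarrow> h' u = h u" "dominated E h v"
  shows "dominated E' h' v"
proof -
  have "h' w = h w" if "{v, w} \<in> E" for w
    using simple_graph_edge[OF assms(1) that] assms(4) by blast
  then show ?thesis
    using assms unfolding dominated_def by (metis subsetD)
qed

text \<open>Subtracting \<open>card (AN E h v)\<close> from the 3RDF inequality leaves the excesses
  \<open>h w - 1\<close>. This bookkeeping serves the upper and the lower bound; the subtraction is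
  exact because active labels are positive.\<close>

lemma sum_eq_card_plus_excess:
  fixes h :: "'a \<Rightarrow> nat"
  assumes "\<And>a. a \<in> A \<Longrightarrow> h a \<ge> 1"
  shows "sum h A = card A + (\<Sum>a\<in>A. h a - 1)"
proof -
  have "sum h A = (\<Sum>a\<in>A. 1 + (h a - 1))"
    using assms by (intro sum.cong) fastforce+
  also have "\<dots> = card A + (\<Sum>a\<in>A. h a - 1)"
    by (simp only: sum.distrib) simp
  finally show ?thesis .
qed

lemma sum_ge_card_plus_excess:
  fixes h :: "'a \<Rightarrow> nat"
  assumes "finite A" "\<And>a. a \<in> A \<Longrightarrow> h a \<ge> 1" "W \<subseteq> A"
  shows "sum h A \<ge> card A + (\<Sum>w\<in>W. h w - 1)"
  using sum_eq_card_plus_excess[of A h, OF assms(2)] sum_mono2[OF assms(1,3), of "\<lambda>a. h a - 1"] by simp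

text \<open>A neighbour labelled 4 has excess 3, and two neighbours labelled 3 have excess 2 + 2;
  either reaches the required 3.\<close>

lemma is_3RDF_if_dominated:
  assumes "simple_graph V E" "\<And>v. v \<in> V \<Longrightarrow> h v \<le> 4" "\<And>v. v \<in> V \<Longrightarrow> dominated E h v"
  shows "is_3RDF V E h"
  unfolding is_3RDF_def
proof (intro conjI ballI impI)
  fix v assume v: "v \<in> V" and lt: "h v < 3"
  have sub: "AN E h v \<subseteq> V" and nin: "v \<notin> AN E h v"
    using simple_graph_edge[OF assms(1)] unfolding AN_def nbhd_def by (blast, blast)
  have fin: "finite (AN E h v)"
    using sub assms(1) finite_subset unfolding simple_graph_def by blast
  have ge: "h a \<ge> 1" if "a \<in> AN E h v" for a
    using that unfolding AN_def by auto
  note bd = sum_ge_card_plus_excess[of "AN E h v" h, OF fin ge]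
  have "sum h (AN E h v) \<ge> card (AN E h v) + 3"
    using assms(3)[OF v] lt unfolding dominated_def
  proof (elim disjE exE conjE)
    fix w assume "{v, w} \<in> E" "h w = 4"
    then show ?thesis using bd[where W = "{w}"] unfolding AN_def nbhd_def by auto
  next
    fix w w' assume "w \<noteq> w'" "{v, w} \<in> E" "{v, w'} \<in> E" "h w = 3" "h w' = 3"
    then show ?thesis using bd[where W = "{w, w'}"] unfolding AN_def nbhd_def by auto
  qed auto
  then show "sum h (ANc E h v) \<ge> card (AN E h v) + 3"
    unfolding ANc_def using fin nin by simp
qed (use assms(2) in auto)

lemma gamma3R_le: "is_3RDF V E h \<Longrightarrow> gamma3R V E \<le> sum h V"
  unfolding gamma3R_def by (rule Least_le) blast

section \<open>Splitting a tree at an edge\<close>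

text \<open>The connected component of the second endpoint \<open>y\<close> once the edge
  \<open>{x, y}\<close> is deleted; exchanging the arguments gives the component of
  \<open>x\<close>.\<close>

definition side :: "'a set set \<Rightarrow> 'a \<Rightarrow> 'a \<Rightarrow> 'a set" where
  "side E x y = {v. (y, v) \<in> (adj_rel (E - {{x, y}}))\<^sup>*}"

lemma rtrancl_adj_rel_sym: "(x, y) \<in> (adj_rel E)\<^sup>* \<Longrightarrow> (y, x) \<in> (adj_rel E)\<^sup>*"
proof -
  have "sym (adj_rel E)" by (auto simp: sym_def adj_rel_def insert_commute)
  then show "(x, y) \<in> (adj_rel E)\<^sup>* \<Longrightarrow> (y, x) \<in> (adj_rel E)\<^sup>*"
    using sym_rtrancl symD by metis
qed

lemma rtrancl_adj_rel_mono: "(x, y) \<in> (adj_rel E)\<^sup>* \<Longrightarrow> E \<subseteq> E' \<Longrightarrow> (x, y) \<in> (adj_rel E')\<^sup>*"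
  by (rule subsetD[OF rtrancl_mono]) (auto simp: adj_rel_def)

text \<open>Loop erasure: when the walk comes back to a visited vertex, the list is cut after the
  earlier visit. Distinctness is required for building an \<open>is_cycle\<close> list.\<close>

lemma rtrancl_imp_distinct_path:
  assumes "(x, y) \<in> r\<^sup>*"
  shows "\<exists>xs. xs \<noteq> [] \<and> distinct xs \<and> hd xs = x \<and> last xs = y \<and> successively (\<lambda>u w. (u, w) \<in> r) xs"
  using assms
proof induction
  case base
  show ?case by (rule exI[of _ "[x]"]) simp
next
  case (step y z)
  then obtain xs where xs: "xs \<noteq> []" "distinct xs" "hd xs = x" "last xs = y"
      "successively (\<lambda>u w. (u, w) \<in> r) xs" by blast
  show ?case
  proof (cases "z \<in> set xs")
    case True
    then obtain as bs where [simp]: "xs = as @ z # bs" by (meson split_list)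
    show ?thesis
      using xs by (intro exI[of _ "as @ [z]"]) (auto simp: successively_append_iff hd_append)
  next
    case False
    then show ?thesis
      using xs step(2) by (intro exI[of _ "xs @ [z]"]) (auto simp: successively_append_iff)
  qed
qed

text \<open>A path from \<open>y\<close> to \<open>x\<close> avoiding the edge \<open>{x, y}\<close>
  would be closed to a cycle by that edge.\<close>

lemma tree_edge_bridge:
  assumes "is_tree V E" "{x, y} \<in> E"
  shows "x \<notin> side E x y"
proof
  assume "x \<in> side E x y"
  then have "(y, x) \<in> (adj_rel (E - {{x, y}}))\<^sup>*"
    unfolding side_def by simp
  from rtrancl_imp_distinct_path[OF this] obtain xs where xs: "xs \<noteq> []" "distinct xs" "hd xs = y" "last xs = x"
      "successively (\<lambda>u w. (u, w) \<in> adj_rel (E - {{x, y}})) xs"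
    by blast
  have ne: "x \<noteq> y"
    using assms simple_graph_edge(3) unfolding is_tree_def by metis
  obtain a b zs where xs_eq: "xs = a # b # zs"
    using xs(1,3,4) ne by (cases xs; cases "tl xs") auto
  \<comment> \<open>A path with just two vertices would be the deleted edge itself.\<close>
  have "zs \<noteq> []"
    using xs xs_eq by (auto simp: adj_rel_def insert_commute)
  then have len: "length xs \<ge> 3"
    using xs_eq by (cases zs) auto
  have "{xs ! i, xs ! (i + 1)} \<in> E" if "i + 1 < length xs" for i
    using xs(5) that by (auto simp: successively_conv_nth adj_rel_def)
  then have "is_cycle E xs"
    using xs len assms(2) unfolding is_cycle_def by auto
  then show False using assms(1) unfolding is_tree_def by blast
qed

lemma side_closed:
  assumes "u \<in> side E x y" "{u, w} \<in> E" "{u, w} \<noteq> {x, y}"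
  shows "w \<in> side E x y"
proof -
  have "(u, w) \<in> adj_rel (E - {{x, y}})" using assms by (simp add: adj_rel_def)
  then show ?thesis
    using assms(1) unfolding side_def by (simp add: rtrancl_into_rtrancl)
qed

lemma root_in_side: "y \<in> side E x y"
  unfolding side_def by simp

lemma side_subset:
  assumes "simple_graph V E" "{x, y} \<in> E"
  shows "side E x y \<subseteq> V"
proof
  fix v assume "v \<in> side E x y"
  then have "(y, v) \<in> (adj_rel (E - {{x, y}}))\<^sup>*" unfolding side_def by simp
  then show "v \<in> V"
    by induction (use simple_graph_edge[OF assms(1)] assms(2) in \<open>auto simp: adj_rel_def\<close>)
qed

text \<open>A walk from \<open>y\<close> that avoids the deleted edge never leaves the side, so all
  its edges lie inside; acyclicity passes to subsets of the edges.\<close>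

lemma side_is_tree:
  assumes "is_tree V E" "{x, y} \<in> E"
  shows "is_tree (side E x y) {f \<in> E. f \<subseteq> side E x y}"
proof -
  let ?S = "side E x y" and ?F = "{f \<in> E. f \<subseteq> side E x y}"
  have sg: "simple_graph V E" using assms unfolding is_tree_def by simp
  have fin: "finite ?S"
    using side_subset[OF sg assms(2)] sg finite_subset unfolding simple_graph_def by blast
  have reach: "(y, v) \<in> (adj_rel ?F)\<^sup>*" if "v \<in> ?S" for v
  proof -
    from that have "(y, v) \<in> (adj_rel (E - {{x, y}}))\<^sup>*" unfolding side_def by simp
    then have "(y, v) \<in> (adj_rel ?F)\<^sup>* \<and> v \<in> ?S"
    proof induction
      case base
      then show ?case by (simp add: root_in_side)
    next
      case (step u w)
      then have "{u, w} \<in> E" "{u, w} \<noteq> {x, y}" by (auto simp: adj_rel_def)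
      with step have "w \<in> ?S" using side_closed by metis
      with step have "(u, w) \<in> adj_rel ?F" by (auto simp: adj_rel_def)
      with step \<open>w \<in> ?S\<close> show ?case by (auto intro: rtrancl_into_rtrancl)
    qed
    then show ?thesis by simp
  qed
  have "connected_graph ?S ?F"
    unfolding connected_graph_def
    by (intro ballI) (rule rtrancl_trans[OF rtrancl_adj_rel_sym[OF reach] reach])
  moreover have "simple_graph ?S ?F"
    using sg fin by (rule_tac simple_graph_mono) auto
  moreover have "\<not> (\<exists>xs. is_cycle ?F xs)"
    using assms unfolding is_tree_def is_cycle_def by blast
  ultimately show ?thesis
    unfolding is_tree_def using root_in_side[of y E x] by auto
qed

text \<open>A common vertex would link \<open>y\<close> to \<open>x\<close> without the edge,
  against \<open>tree_edge_bridge\<close>.\<close>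

lemma sides_disjoint:
  assumes "is_tree V E" "{x, y} \<in> E"
  shows "side E x y \<inter> side E y x = {}"
proof -
  have "x \<in> side E x y" if "v \<in> side E x y" "v \<in> side E y x" for v
  proof -
    have "(y, v) \<in> (adj_rel (E - {{x, y}}))\<^sup>*" "(x, v) \<in> (adj_rel (E - {{x, y}}))\<^sup>*"
      using that unfolding side_def by (simp_all add: insert_commute)
    then show ?thesis
      unfolding side_def using rtrancl_trans[OF _ rtrancl_adj_rel_sym] by simp
  qed
  then show ?thesis using tree_edge_bridge[OF assms] by blast
qed

text \<open>Along a walk from \<open>x\<close>, only the deleted edge can change the side, and both
  its ends are roots of sides.\<close>

lemma sides_cover:
  assumes "is_tree V E" "{x, y} \<in> E"
  shows "V = side E x y \<union> side E y x"
proof -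
  have sg: "simple_graph V E" and con: "connected_graph V E"
    using assms unfolding is_tree_def by auto
  have yx: "{y, x} \<in> E" using assms(2) by (simp add: insert_commute)
  have "v \<in> side E x y \<union> side E y x" if "v \<in> V" for v
  proof -
    have "(x, v) \<in> (adj_rel E)\<^sup>*"
      using con that simple_graph_edge[OF sg assms(2)] unfolding connected_graph_def by blast
    then show ?thesis
    proof induction
      case base
      then show ?case by (simp add: root_in_side)
    next
      case (step u w)
      show ?case
      proof (cases "{u, w} = {x, y}")
        case True
        then show ?thesis using root_in_side by (metis UnCI doubleton_eq_iff)
      next
        case False
        then show ?thesis
          using step side_closed[of u E _ _ w] unfolding adj_rel_def
          by (auto simp: insert_commute)
      qed
    qed
  qed
  then show ?thesis using side_subset[OF sg assms(2)] side_subset[OF sg yx] by blast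
qed

lemma edges_split:
  assumes "is_tree V E" "{x, y} \<in> E"
  shows "E = insert {x, y} ({f \<in> E. f \<subseteq> side E x y} \<union> {f \<in> E. f \<subseteq> side E y x})"
proof -
  have sg: "simple_graph V E" using assms unfolding is_tree_def by auto
  have "f \<subseteq> side E x y \<or> f \<subseteq> side E y x" if f: "f \<in> E" "f \<noteq> {x, y}" for f
  proof -
    obtain u w where uw: "f = {u, w}" "u \<in> V" "w \<in> V"
      using sg f unfolding simple_graph_def by metis
    show ?thesis
      using uw f sides_cover[OF assms] side_closed[of u E x y w] side_closed[of u E y x w]
      by (auto simp: insert_commute)
  qed
  then show ?thesis using assms(2) by blast
qed

text \<open>This is the strict descent behind the choice of a center. A walk from \<open>z\<close>
  avoiding \<open>{y, z}\<close> never meets \<open>y\<close>, hence never uses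
  \<open>{x, y}\<close>; and \<open>y\<close> itself lies only in the larger side.\<close>

lemma side_nested:
  assumes "is_tree V E" "{x, y} \<in> E" "{y, z} \<in> E" "z \<noteq> x"
  shows "side E y z \<subset> side E x y"
proof -
  have "(z, v) \<in> (adj_rel (E - {{x, y}}))\<^sup>*" if "v \<in> side E y z" for v
  proof -
    from that have "(z, v) \<in> (adj_rel (E - {{y, z}}))\<^sup>*" unfolding side_def by simp
    then have "(z, v) \<in> (adj_rel (E - {{x, y}}))\<^sup>* \<and> v \<in> side E y z"
    proof induction
      case base
      then show ?case by (simp add: root_in_side)
    next
      case (step u w)
      then have uw: "{u, w} \<in> E" "{u, w} \<noteq> {y, z}" by (auto simp: adj_rel_def)
      with step have w: "w \<in> side E y z" using side_closed by metis
      have "u \<noteq> y" "w \<noteq> y"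
        using w step tree_edge_bridge[OF assms(1,3)] by auto
      with uw have "(u, w) \<in> adj_rel (E - {{x, y}})"
        by (auto simp: adj_rel_def doubleton_eq_iff)
      with step w show ?case by (auto intro: rtrancl_into_rtrancl)
    qed
    then show ?thesis by simp
  qed
  moreover have "(y, z) \<in> adj_rel (E - {{x, y}})"
    using assms(3,4) by (auto simp: adj_rel_def doubleton_eq_iff)
  ultimately have "side E y z \<subseteq> side E x y"
    unfolding side_def by (auto intro: converse_rtrancl_into_rtrancl)
  then show ?thesis
    using tree_edge_bridge[OF assms(1,3)] root_in_side[of y E x] by blast
qed

text \<open>Follow a walk from \<open>c\<close>: it enters a branch only through an edge at
  \<open>c\<close> and then stays in that branch until it returns to \<open>c\<close>.\<close>

lemma tree_branches_cover:
  assumes "is_tree V E" "c \<in> V" "v \<in> V" "v \<noteq> c"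
  shows "\<exists>y. {c, y} \<in> E \<and> v \<in> side E c y"
proof -
  have "(c, v) \<in> (adj_rel E)\<^sup>*"
    using assms unfolding is_tree_def connected_graph_def by blast
  then have "v = c \<or> (\<exists>y. {c, y} \<in> E \<and> v \<in> side E c y)"
  proof induction
    case (step u w)
    then have uw: "{u, w} \<in> E" by (simp add: adj_rel_def)
    from step(3) show ?case
    proof
      assume "u = c"
      then show ?thesis using uw root_in_side[of w E c] by blast
    next
      assume "\<exists>y. {c, y} \<in> E \<and> u \<in> side E c y"
      then obtain y where y: "{c, y} \<in> E" "u \<in> side E c y" by blast
      then have "u \<noteq> c" using tree_edge_bridge assms(1) by metis
      then show ?thesis
        using y uw side_closed[OF y(2) uw] by (cases "w = c") (auto simp: doubleton_eq_iff)
    qed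
  qed simp
  then show ?thesis using assms by simp
qed


section \<open>Upper bounds from labellings\<close>

text \<open>Here \<open>w\<close> bounds the weight instead of being equal to it, so estimates for
  parts of a tree can simply be added.\<close>

definition dominable :: "'a set \<Rightarrow> 'a set set \<Rightarrow> nat \<Rightarrow> bool" where
  "dominable V E w \<longleftrightarrow> (\<exists>h. (\<forall>u\<in>V. h u \<le> 4 \<and> dominated E h u) \<and> sum h V \<le> w)"

lemma gamma3R_le_if_dominable:
  assumes "simple_graph V E" "dominable V E w"
  shows "gamma3R V E \<le> w"
proof -
  obtain h where h: "\<forall>u\<in>V. h u \<le> 4 \<and> dominated E h u" "sum h V \<le> w"
    using assms(2) unfolding dominable_def by blast
  then have "is_3RDF V E h" by (intro is_3RDF_if_dominated assms(1)) auto
  then show ?thesis using gamma3R_le h(2) order_trans by blast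
qed

section \<open>The family as a predicate on presentations\<close>

text \<open>The witnesses of \<open>in_family_F\<close> are made explicit so that single path
  vertices can be labelled; the path edges are spelled out per path to avoid arithmetic in the
  second index.\<close>

definition F_presentation ::
    "'a set \<Rightarrow> 'a set set \<Rightarrow> nat \<Rightarrow> (nat \<times> nat \<Rightarrow> 'a) \<Rightarrow> 'a set set \<Rightarrow> bool" where
  "F_presentation V E k v S \<longleftrightarrow> k \<ge> 1 \<and> inj_on v ({..<k} \<times> {1..4}) \<and> V = v ` ({..<k} \<times> {1..4}) \<and>
     S \<subseteq> {{v (i, 2), v (j, 2)} | i j. i < k \<and> j < k \<and> i \<noteq> j} \<and> card S = k - 1 \<and>
     connected_graph (v ` ({..<k} \<times> {2})) S \<and>
     E = (\<Union>i<k. {{v (i, 1), v (i, 2)}, {v (i, 2), v (i, 3)}, {v (i, 3), v (i, 4)}}) \<union> S"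

lemma in_family_F_iff: "in_family_F V E \<longleftrightarrow> (\<exists>k v S. F_presentation V E k v S)"
proof -
  have "{{v (i, j), v (i, j + 1)} | i j. i < k \<and> 1 \<le> j \<and> j \<le> 3} =
      (\<Union>i<k. {{v (i, 1), v (i, 2)}, {v (i, 2), v (i, 3)}, {v (i, 3), v (i, 4)}})"
    (is "?L = ?R") for k and v :: "nat \<times> nat \<Rightarrow> 'a"
  proof -
    have "e \<in> ?R" if e: "e \<in> ?L" for e
    proof -
      obtain i j where ij: "e = {v (i, j), v (i, j + 1)}" "i < k" "1 \<le> j" "j \<le> 3"
        using e by blast
      then have "j = 1 \<or> j = 2 \<or> j = 3" by auto
      then have "e \<in> {{v (i, 1), v (i, 2)}, {v (i, 2), v (i, 3)}, {v (i, 3), v (i, 4)}}"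
        using ij(1) by (elim disjE) (simp_all add: numeral_eq_Suc)
      then show ?thesis using ij(2) by blast
    qed
    moreover have "{v (i, 1), v (i, 2)} \<in> ?L \<and> {v (i, 2), v (i, 3)} \<in> ?L \<and> {v (i, 3), v (i, 4)} \<in> ?L"
      if "i < k" for i
    proof (intro conjI CollectI)
      show "\<exists>i' j. {v (i, 1), v (i, 2)} = {v (i', j), v (i', j + 1)} \<and> i' < k \<and> 1 \<le> j \<and> j \<le> 3"
        using that by (intro exI[of _ i] exI[of _ 1]) (simp add: numeral_eq_Suc)
      show "\<exists>i' j. {v (i, 2), v (i, 3)} = {v (i', j), v (i', j + 1)} \<and> i' < k \<and> 1 \<le> j \<and> j \<le> 3"
        using that by (intro exI[of _ i] exI[of _ 2]) (simp add: numeral_eq_Suc)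
      show "\<exists>i' j. {v (i, 3), v (i, 4)} = {v (i', j), v (i', j + 1)} \<and> i' < k \<and> 1 \<le> j \<and> j \<le> 3"
        using that by (intro exI[of _ i] exI[of _ 3]) (simp add: numeral_eq_Suc)
    qed
    ultimately show ?thesis by blast
  qed
  then show ?thesis unfolding in_family_F_def F_presentation_def by simp
qed

lemma atLeast1AtMost4: "{1..4::nat} = {1, 2, 3, 4}" by auto

text \<open>The backbone vertex is recorded because reading a path backwards makes its other inner
  vertex the backbone vertex.\<close>

lemma P4_presentation:
  assumes "distinct [a, b, c, d]"
  shows "\<exists>v. F_presentation {a, b, c, d} {{a, b}, {b, c}, {c, d}} 1 v {} \<and> v (0, 2) = b"
proof -
  define v where "v = (\<lambda>(i::nat, j::nat). if j = 1 then a else if j = 2 then b else if j = 3 then c else d)"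
  have "inj_on v ({..<1} \<times> {1..4})"
    using assms unfolding atLeast1AtMost4 v_def inj_on_def by auto
  moreover have "{a, b, c, d} = v ` ({..<1} \<times> {1..4})"
    unfolding atLeast1AtMost4 v_def by (auto simp: image_iff)
  moreover have "connected_graph (v ` ({..<1} \<times> {2})) {}"
    unfolding connected_graph_def v_def by auto
  ultimately have "F_presentation {a, b, c, d} {{a, b}, {b, c}, {c, d}} 1 v {}"
    unfolding F_presentation_def by (simp add: v_def lessThan_Suc)
  moreover have "v (0, 2) = b" unfolding v_def by simp
  ultimately show ?thesis by blast
qed

section \<open>Spiders\<close>

text \<open>Among the oriented edges whose far side is large, take one with the smallest far side,
  rooted at \<open>c\<close>. The branch back across this edge is small by \<open>unsplit\<close>,
  the other branches by minimality. If there is no such edge, every vertex is a center.\<close>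

lemma exists_center:
  assumes tree: "is_tree V E"
    and unsplit: "\<And>x y. {x, y} \<in> E \<Longrightarrow> card (side E x y) \<le> 2 \<or> card (side E y x) \<le> 2"
  shows "\<exists>c\<in>V. \<forall>y. {c, y} \<in> E \<longrightarrow> card (side E c y) \<le> 2"
proof (cases "\<exists>p. {fst p, snd p} \<in> E \<and> \<not> card (side E (fst p) (snd p)) \<le> 2")
  case True
  then obtain p where p: "{fst p, snd p} \<in> E" "\<not> card (side E (fst p) (snd p)) \<le> 2"
    and least: "\<And>q. {fst q, snd q} \<in> E \<and> \<not> card (side E (fst q) (snd q)) \<le> 2 \<Longrightarrow>
      card (side E (fst p) (snd p)) \<le> card (side E (fst q) (snd q))"
    using ex_has_least_nat[of "\<lambda>p. {fst p, snd p} \<in> E \<and> \<not> card (side E (fst p) (snd p)) \<le> 2"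
        _ "\<lambda>p. card (side E (fst p) (snd p))"] by blast
  obtain x c where [simp]: "p = (x, c)" by (cases p)
  have sg: "simple_graph V E" using tree unfolding is_tree_def by simp
  have xc: "{x, c} \<in> E" using p by simp
  have fin: "finite (side E x c)"
    using side_subset[OF sg xc] sg finite_subset unfolding simple_graph_def by blast
  have "card (side E c z) \<le> 2" if z: "{c, z} \<in> E" for z
  proof (cases "z = x")
    case True
    then show ?thesis using unsplit[OF xc] p by simp
  next
    case False
    then have "card (side E c z) < card (side E x c)"
      using psubset_card_mono[OF fin side_nested[OF tree xc z]] by simp
    then show ?thesis using least[of "(c, z)"] z by fastforce
  qed
  then show ?thesis using simple_graph_edge[OF sg xc] by blast
next
  case False
  then show ?thesis using tree unfolding is_tree_def by fastforce
qed

text \<open>\<open>N\<close> collects the neighbours of the center and \<open>D\<close> the outer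
  ends of the legs of length two. Labels are constant on \<open>{c}\<close>, \<open>N\<close> and
  \<open>D\<close>: the patterns 4, 0, 3 and 0, 4, 0 and 3, 0, 3 cover everything except the path on
  four vertices.\<close>

lemma spider_dominable_or_in_family_F:
  assumes tree: "is_tree V E" and c: "c \<in> V" and p3: "card V \<ge> 3"
    and small: "\<And>y. {c, y} \<in> E \<Longrightarrow> card (side E c y) \<le> 2"
  shows "(\<exists>w. dominable V E w \<and> 4 * w < 7 * card V) \<or> in_family_F V E"
proof -
  have sg: "simple_graph V E" using tree unfolding is_tree_def by simp
  have finV: "finite V" using sg unfolding simple_graph_def by simp
  define N where "N = nbhd E c"
  define D where "D = V - insert c N"
  have NV: "N \<subseteq> V" and cN: "c \<notin> N"
    using simple_graph_edge[OF sg] unfolding N_def nbhd_def by (blast, blast)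
  have N_iff: "y \<in> N \<longleftrightarrow> {c, y} \<in> E" "y \<in> N \<longleftrightarrow> {y, c} \<in> E" for y
    unfolding N_def nbhd_def by (auto simp: insert_commute)
  have V_eq: "V = insert c (N \<union> D)" using NV c unfolding D_def by blast
  have fin: "finite N" "finite D" using finV NV finite_subset unfolding D_def by auto
  have disj: "N \<inter> D = {}" "c \<notin> D" unfolding D_def by auto
  have sum_eq: "sum (\<lambda>v. if v = c then a else if v \<in> N then b else d) V
      = a + b * card N + d * card D" for a b d :: nat
  proof -
    have "sum (\<lambda>v. if v = c then a else if v \<in> N then b else d) N = b * card N"
      using cN by (subst sum.cong[where h = "\<lambda>_. b"]) auto
    moreover have "sum (\<lambda>v. if v = c then a else if v \<in> N then b else d) D = d * card D"
      using disj by (subst sum.cong[where h = "\<lambda>_. d"]) auto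
    ultimately show ?thesis
      unfolding V_eq using fin disj cN by (simp add: sum.union_disjoint)
  qed
  have cardV: "card V = 1 + card N + card D"
    using fin disj cN by (subst V_eq) (simp add: card_Un_disjoint)
  have "\<exists>y. {c, y} \<in> E \<and> {y, v} \<in> E \<and> side E c y = {y, v}" if v: "v \<in> D" for v
  proof -
    have v': "v \<in> V" "v \<noteq> c" using v unfolding D_def by auto
    obtain y where y: "{c, y} \<in> E" "v \<in> side E c y"
      using tree_branches_cover[OF tree c v'] by blast
    have ne: "v \<noteq> y" using v y N_iff disj by auto
    have fs: "finite (side E c y)"
      using side_subset[OF sg y(1)] finV finite_subset by blast
    have eq: "side E c y = {y, v}"
      using card_seteq[OF fs, of "{y, v}"] y root_in_side[of y E c] small[OF y(1)] ne by auto
    \<comment> \<open>The branch consists of \<open>y\<close> and \<open>v\<close> only, so the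
      first step of a walk from \<open>y\<close> to \<open>v\<close> already ends in
      \<open>v\<close>.\<close>
    have "(y, v) \<in> (adj_rel (E - {{c, y}}))\<^sup>*" using y(2) unfolding side_def by simp
    then obtain u where u: "(y, u) \<in> adj_rel (E - {{c, y}})"
      using ne by (metis converse_rtranclE)
    then have e: "{y, u} \<in> E" "{y, u} \<noteq> {c, y}" by (auto simp: adj_rel_def)
    have "u \<in> side E c y" using side_closed[OF root_in_side e] .
    moreover have "u \<noteq> y" using simple_graph_edge[OF sg e(1)] by blast
    ultimately have "u = v" using eq by simp
    then show ?thesis using y e eq by blast
  qed
  then obtain f where f: "\<And>v. v \<in> D \<Longrightarrow> {c, f v} \<in> E \<and> {f v, v} \<in> E \<and> side E c (f v) = {f v, v}"
    by metis
  have fN: "f ` D \<subseteq> N" using f N_iff by blast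
  have fne: "v \<noteq> f v" if "v \<in> D" for v using that fN disj by auto
  have inj: "inj_on f D"
  proof (rule inj_onI)
    fix v v' assume "v \<in> D" "v' \<in> D" "f v = f v'"
    then show "v = v'" using f[of v] f[of v'] fne by (metis doubleton_eq_iff)
  qed
  have le: "card D \<le> card N" using card_inj_on_le[OF inj fN fin(1)] .
  \<comment> \<open>The first inequality says that the weight \<open>4 + 3 * card D\<close> is below
    7/4 of the order. If it fails while \<open>card N > card D\<close>, then
    \<open>card V \<ge> 3\<close> leaves only \<open>card D = 1\<close> and
    \<open>card N = 2\<close>. For equal cardinalities, weight \<open>4 * card N\<close> suffices up
    to 3 legs and \<open>3 + 3 * card D\<close> beyond.\<close>
  consider (center4) "9 + 5 * card D < 7 * card N" | (P4) "card D = 1" "card N = 2"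
    | (nbrs4) "card N = card D" "card D \<le> 3" | (center3) "card N = card D" "card D > 3"
    using le p3 cardV by linarith
  then show ?thesis
  proof cases
    case center4
    define h where "h = (\<lambda>v. if v = c then 4 else if v \<in> N then 0 else (3::nat))"
    have "\<forall>u\<in>V. h u \<le> 4 \<and> dominated E h u"
      unfolding dominated_def h_def using N_iff by auto
    then have "dominable V E (4 + 3 * card D)"
      unfolding dominable_def using sum_eq[of 4 0 3] unfolding h_def
      by (intro exI[of _ h]) (simp add: h_def)
    then show ?thesis using center4 cardV by (intro disjI1 exI[of _ "4 + 3 * card D"]) auto
  next
    case nbrs4
    define h where "h = (\<lambda>v. if v = c then 0 else if v \<in> N then 4 else (0::nat))"
    obtain y where y: "y \<in> N" using cardV p3 nbrs4 by fastforce
    have "dominated E h u" if u: "u \<in> V" for u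
    proof -
      consider "u = c" | "u \<in> N" | "u \<in> D" using u V_eq by blast
      then show ?thesis
      proof cases
        case 1
        then have "{u, y} \<in> E" "h y = 4" using y cN N_iff unfolding h_def by auto
        then show ?thesis by (rule dominated_neighbour)
      next
        case 2
        then show ?thesis using cN unfolding h_def by (intro dominated_self) auto
      next
        case 3
        then have "f u \<in> N" "{u, f u} \<in> E" using f[of u] fN by (auto simp: insert_commute)
        moreover from this have "h (f u) = 4" using cN unfolding h_def by auto
        ultimately show ?thesis using dominated_neighbour by metis
      qed
    qed
    then have "dominable V E (4 * card N)"
      unfolding dominable_def using sum_eq[of 0 4 0]
      by (intro exI[of _ h]) (auto simp: h_def)
    then show ?thesis using nbrs4 cardV by (intro disjI1 exI[of _ "4 * card N"]) auto
  next
    case center3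
    define h where "h = (\<lambda>v. if v = c then 3 else if v \<in> N then 0 else (3::nat))"
    \<comment> \<open>No leg has length one, so every neighbour of the center sees two labels 3: the
      center and the end of its own leg.\<close>
    have surj: "f ` D = N"
      using card_subset_eq[OF fin(1) fN] card_image[OF inj] center3 by simp
    have "dominated E h u" if u: "u \<in> V" for u
    proof (cases "u \<in> N")
      case True
      then obtain v where v: "v \<in> D" "u = f v" using surj by blast
      then have "h c = 3" "h v = 3" "{u, c} \<in> E" "{u, v} \<in> E" "c \<noteq> v"
        using f[OF v(1)] disj unfolding h_def by (auto simp: insert_commute)
      then show ?thesis unfolding dominated_def by blast
    next
      case False
      then show ?thesis unfolding dominated_def h_def by auto
    qed
    then have "dominable V E (3 + 3 * card D)"
      unfolding dominable_def using sum_eq[of 3 0 3]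
      by (intro exI[of _ h]) (auto simp: h_def)
    then show ?thesis using center3 cardV by (intro disjI1 exI[of _ "3 + 3 * card D"]) auto
  next
    case P4
    obtain z where D: "D = {z}" using P4 card_1_singletonE by metis
    define y where "y = f z"
    have yN: "y \<in> N" using fN D unfolding y_def by auto
    then have "card (N - {y}) = 1" using P4 fin by simp
    then obtain x where "N - {y} = {x}" using card_1_singletonE by metis
    then have N: "N = {x, y}" and xy: "x \<noteq> y" using yN by auto
    have yz: "{y, z} \<in> E" using f[of z] D unfolding y_def by auto
    have dist: "distinct [x, c, y, z]" using N D disj cN xy by auto
    have Vs: "V = {x, c, y, z}" using V_eq N D by auto
    \<comment> \<open>Acyclicity excludes the chords \<open>{x, y}\<close> (a triangle) and
      \<open>{x, z}\<close> (a 4-cycle); \<open>{c, z}\<close> is excluded since \<open>z\<close> is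
      not a neighbour of \<open>c\<close>.\<close>
    have no: "\<not> is_cycle E xs" for xs using tree unfolding is_tree_def by blast
    have edges: "{x, c} \<in> E" "{c, y} \<in> E" using N N_iff by auto
    have n1: "{x, y} \<notin> E"
      using no[of "[x, c, y]"] dist edges
      unfolding is_cycle_def by (auto simp: nth_Cons insert_commute split: nat.splits)
    have n2: "{c, z} \<notin> E" using D disj N_iff by auto
    have n3: "{x, z} \<notin> E"
      using no[of "[x, c, y, z]"] dist edges yz
      unfolding is_cycle_def by (auto simp: nth_Cons insert_commute less_Suc_eq split: nat.splits)
    have "e \<in> {{x, c}, {c, y}, {y, z}}" if e: "e \<in> E" for e
    proof -
      obtain u w where uw: "e = {u, w}" "u \<noteq> w" "u \<in> V" "w \<in> V"
        using sg e unfolding simple_graph_def by metis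
      then show ?thesis using e n1 n2 n3 unfolding Vs by (auto simp: insert_commute)
    qed
    then have Es: "E = {{x, c}, {c, y}, {y, z}}" using edges yz by blast
    have "in_family_F V E"
      using P4_presentation[OF dist] unfolding in_family_F_iff Vs Es by blast
    then show ?thesis ..
  qed
qed

section \<open>Labellings of members of the family\<close>

lemma F_presentation_edges:
  assumes "F_presentation V E k v S" "i < k"
  shows "{v (i, 1), v (i, 2)} \<in> E" "{v (i, 2), v (i, 3)} \<in> E" "{v (i, 3), v (i, 4)} \<in> E"
    "{v (i, 2), v (i, 1)} \<in> E" "{v (i, 3), v (i, 2)} \<in> E" "{v (i, 4), v (i, 3)} \<in> E"
proof -
  have E: "E = (\<Union>i<k. {{v (i, 1), v (i, 2)}, {v (i, 2), v (i, 3)}, {v (i, 3), v (i, 4)}}) \<union> S"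
    using assms(1) unfolding F_presentation_def by simp
  show "{v (i, 1), v (i, 2)} \<in> E" "{v (i, 2), v (i, 3)} \<in> E" "{v (i, 3), v (i, 4)} \<in> E"
    unfolding E using assms(2) by blast+
  then show "{v (i, 2), v (i, 1)} \<in> E" "{v (i, 3), v (i, 2)} \<in> E" "{v (i, 4), v (i, 3)} \<in> E"
    by (simp_all add: insert_commute)
qed

lemma F_presentation_inj:
  assumes "F_presentation V E k v S" "i < k" "i' < k" "j \<in> {1..4}" "j' \<in> {1..4}"
  shows "v (i, j) = v (i', j') \<longleftrightarrow> i = i' \<and> j = j'"
  using assms inj_on_eq_iff[of v "{..<k} \<times> {1..4}" "(i, j)" "(i', j')"]
  unfolding F_presentation_def by simp

lemma F_presentation_vertexE:
  assumes "F_presentation V E k v S" "u \<in> V"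
  obtains i j where "i < k" "j \<in> {1..4}" "u = v (i, j)"
  using assms unfolding F_presentation_def by auto

lemma F_presentation_vertex:
  assumes "F_presentation V E k v S" "i < k" "j \<in> {1..4}"
  shows "v (i, j) \<in> V"
  using assms unfolding F_presentation_def by auto

lemma F_presentation_sum:
  assumes "F_presentation V E k v S"
  shows "sum h V = (\<Sum>i<k. h (v (i, 1)) + h (v (i, 2)) + h (v (i, 3)) + h (v (i, 4)))"
proof -
  have "sum h V = sum (h \<circ> v) ({..<k} \<times> {1..4})"
    using assms sum.reindex[of v "{..<k} \<times> {1..4}" h] unfolding F_presentation_def by simp
  also have "\<dots> = (\<Sum>i<k. \<Sum>j\<in>{1..4}. h (v (i, j)))"
    by (simp add: sum.cartesian_product)
  finally show ?thesis
    by (simp only: atLeast1AtMost4) (simp add: add.assoc)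
qed

lemma F_presentation_card:
  assumes "F_presentation V E k v S"
  shows "card V = 4 * k"
  using F_presentation_sum[OF assms, of "\<lambda>_. 1 :: nat"] by simp

text \<open>Take the first step of a backbone walk to another path. It supplies
  \<open>v (i, 2)\<close> with a neighbour labelled 4 whenever the other paths carry their standard
  labels.\<close>

lemma F_presentation_backbone_neighbour:
  assumes F: "F_presentation V E k v S" and i: "i < k" and k: "k \<ge> 2"
  obtains i' where "i' < k" "i' \<noteq> i" "{v (i, 2), v (i', 2)} \<in> E"
proof -
  obtain i1 where i1: "i1 < k" "i1 \<noteq> i"
    using k by (metis One_nat_def Suc_1 Suc_le_eq less_2_cases_iff less_le_trans nat_neq_iff pos2)
  have "connected_graph (v ` ({..<k} \<times> {2})) S"
    using F unfolding F_presentation_def by simp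
  then have "(v (i, 2), v (i1, 2)) \<in> (adj_rel S)\<^sup>*"
    using i i1 unfolding connected_graph_def by blast
  moreover have "v (i, 2) \<noteq> v (i1, 2)"
    using F_presentation_inj[OF F i i1(1), of 2 2] i1 by simp
  ultimately obtain w where "(v (i, 2), w) \<in> adj_rel S"
    by (metis converse_rtranclE)
  then have w: "{v (i, 2), w} \<in> S" by (simp add: adj_rel_def)
  moreover have "S \<subseteq> {{v (i, 2), v (j, 2)} | i j. i < k \<and> j < k \<and> i \<noteq> j}"
    using F unfolding F_presentation_def by simp
  ultimately obtain a b where ab: "{v (i, 2), w} = {v (a, 2), v (b, 2)}" "a < k" "b < k" "a \<noteq> b"
    by blast
  have SE: "S \<subseteq> E" using F unfolding F_presentation_def by blast
  from ab(1) consider "v (i, 2) = v (a, 2)" "w = v (b, 2)" | "v (i, 2) = v (b, 2)" "w = v (a, 2)"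
    by (metis doubleton_eq_iff)
  then show ?thesis
  proof cases
    case 1
    then have "i = a" using F_presentation_inj[OF F i ab(2), of 2 2] by simp
    then show ?thesis using that[of b] ab w SE 1 by auto
  next
    case 2
    then have "i = b" using F_presentation_inj[OF F i ab(3), of 2 2] by simp
    then show ?thesis using that[of a] ab w SE 2 by auto
  qed
qed

text \<open>Every path other than the \<open>i\<close>-th carries the optimal labelling \<open>0, 4, 0, 3\<close>; it dominates
  itself, so the labels of the \<open>i\<close>-th path may be chosen freely.\<close>

lemma F_presentation_override:
  assumes F: "F_presentation V E k v S" and i: "i < k" and le: "a \<le> 4" "b \<le> 4" "c \<le> 4" "d \<le> 4"
  obtains h where "\<And>u. u \<in> V \<Longrightarrow> h u \<le> 4"
    "h (v (i, 1)) = a" "h (v (i, 2)) = b" "h (v (i, 3)) = c" "h (v (i, 4)) = d"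
    "sum h V = 7 * (k - 1) + a + b + c + d"
    "\<And>i' j. i' < k \<Longrightarrow> i' \<noteq> i \<Longrightarrow> j \<in> {1..4} \<Longrightarrow> dominated E h (v (i', j))"
    "k \<ge> 2 \<Longrightarrow> dominated E h (v (i, 2))"
proof -
  define D where "D = {..<k} \<times> {1..4::nat}"
  define G where "G = (\<lambda>(i', j). if i' = i
    then (if j = 1 then a else if j = 2 then b else if j = 3 then c else d)
    else (if j = 2 then 4 else if j = (4::nat) then 3 else 0))"
  define h where "h = (\<lambda>u. G (the_inv_into D v u))"
  have inj: "inj_on v D" using F unfolding F_presentation_def D_def by simp
  have h: "h (v (i', j)) = G (i', j)" if "i' < k" "j \<in> {1..4}" for i' j
    unfolding h_def using the_inv_into_f_f[OF inj] that unfolding D_def by auto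
  have other: "h (v (i', 1)) = 0" "h (v (i', 2)) = 4" "h (v (i', 3)) = 0" "h (v (i', 4)) = 3"
    if "i' < k" "i' \<noteq> i" for i'
    using h[OF that(1)] that unfolding G_def by auto
  have own: "h (v (i, 1)) = a" "h (v (i, 2)) = b" "h (v (i, 3)) = c" "h (v (i, 4)) = d"
    using h[OF i] unfolding G_def by auto
  have "sum h V = a + b + c + d +
      (\<Sum>i'\<in>{..<k} - {i}. h (v (i', 1)) + h (v (i', 2)) + h (v (i', 3)) + h (v (i', 4)))"
    unfolding F_presentation_sum[OF F] using i own by (subst sum.remove[of _ i]) auto
  also have "\<dots> = a + b + c + d + (\<Sum>i'\<in>{..<k} - {i}. 7)"
    using other by (intro arg_cong2[of _ _ _ _ "(+)"] sum.cong) auto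
  finally have sum: "sum h V = 7 * (k - 1) + a + b + c + d" using i by simp
  have bound: "h u \<le> 4" if uV: "u \<in> V" for u
  proof -
    obtain i' j where u: "i' < k" "j \<in> {1..4}" "u = v (i', j)"
      using F_presentation_vertexE[OF F uV] .
    then have "h u = G (i', j)" using h by simp
    then show ?thesis using le unfolding G_def by simp
  qed
  have dom: "dominated E h (v (i', j))" if i': "i' < k" "i' \<noteq> i" and j: "j \<in> {1..4}" for i' j
  proof -
    have "j = 1 \<or> j = 2 \<or> j = 3 \<or> j = 4" using j by auto
    then show ?thesis
      using other[OF i'] dominated_self[of h _ E]
        F_presentation_edges[OF F i'(1), THEN dominated_neighbour[where h = h]] by auto
  qed
  have nbr: "dominated E h (v (i, 2))" if k: "k \<ge> 2"
  proof -
    obtain i' where "i' < k" "i' \<noteq> i" "{v (i, 2), v (i', 2)} \<in> E"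
      using F_presentation_backbone_neighbour[OF F i k] by blast
    then show ?thesis using other(2) dominated_neighbour by metis
  qed
  show ?thesis using that[of h] bound own sum dom nbr by blast
qed

section \<open>Labellings adapted to a new edge at a given vertex\<close>

text \<open>The giving side of a new edge: the label 4 at \<open>x\<close> dominates whatever vertex
  is joined to \<open>x\<close>.\<close>

definition heavy_at :: "'a set \<Rightarrow> 'a set set \<Rightarrow> 'a \<Rightarrow> nat \<Rightarrow> bool" where
  "heavy_at V E x w \<longleftrightarrow>
     (\<exists>h. (\<forall>u\<in>V. h u \<le> 4 \<and> dominated E h u) \<and> h x = 4 \<and> sum h V \<le> w)"

text \<open>The receiving side: \<open>x\<close> may be left to a label 4 at the other end of the
  new edge.\<close>

definition dominable_except :: "'a set \<Rightarrow> 'a set set \<Rightarrow> 'a \<Rightarrow> nat \<Rightarrow> bool" where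
  "dominable_except V E x w \<longleftrightarrow>
     (\<exists>h. (\<forall>u\<in>V. h u \<le> 4 \<and> (u = x \<or> dominated E h u)) \<and> sum h V \<le> w)"

text \<open>With standard labels on the other paths, only the \<open>i\<close>-th path needs
  checking, by label 4 neighbours inside it. The index \<open>j - 1\<close> turns positions counted
  from 1 into list positions counted from 0.\<close>

lemma heavy_atI:
  assumes F: "F_presentation V E k v S" and i: "i < k" and j: "j \<in> {1..4}"
    and le: "a \<le> 4" "b \<le> 4" "c \<le> 4" "d \<le> 4"
    and x: "[a, b, c, d] ! (j - 1) = 4"
    and dom: "a \<ge> 3 \<or> b = 4" "b \<ge> 3 \<or> a = 4 \<or> c = 4" "c \<ge> 3 \<or> b = 4 \<or> d = 4" "d \<ge> 3 \<or> c = 4"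
    and w: "7 * (k - 1) + a + b + c + d \<le> w"
  shows "heavy_at V E (v (i, j)) w"
proof -
  obtain h where h: "\<And>u. u \<in> V \<Longrightarrow> h u \<le> 4"
    "h (v (i, 1)) = a" "h (v (i, 2)) = b" "h (v (i, 3)) = c" "h (v (i, 4)) = d"
    "sum h V = 7 * (k - 1) + a + b + c + d"
    "\<And>i' j. i' < k \<Longrightarrow> i' \<noteq> i \<Longrightarrow> j \<in> {1..4} \<Longrightarrow> dominated E h (v (i', j))"
    using F_presentation_override[OF F i le] by metis
  have own: "dominated E h (v (i, 1))" "dominated E h (v (i, 2))"
    "dominated E h (v (i, 3))" "dominated E h (v (i, 4))"
    using dom[folded h(2-5)] dominated_self[of h _ E]
      F_presentation_edges[OF F i, THEN dominated_neighbour[where h = h]] by blast+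
  have "dominated E h u" if uV: "u \<in> V" for u
  proof -
    obtain i' j' where u: "i' < k" "j' \<in> {1..4}" "u = v (i', j')"
      using F_presentation_vertexE[OF F uV] .
    then have "j' = 1 \<or> j' = 2 \<or> j' = 3 \<or> j' = 4" by auto
    then show ?thesis using own u h(7)[OF u(1) _ u(2)] by (cases "i' = i") auto
  qed
  moreover have "h (v (i, j)) = 4"
  proof -
    have "j = 1 \<or> j = 2 \<or> j = 3 \<or> j = 4" using j by auto
    then show ?thesis using x h(2-5) by (auto simp: nth_Cons split: nat.splits)
  qed
  ultimately show ?thesis unfolding heavy_at_def using h(1,6) w by (intro exI[of _ h]) auto
qed

text \<open>As in \<open>heavy_atI\<close>, with an exemption for the excepted position 1, 3 or 4;
  moreover \<open>v (i, 2)\<close> is dominated by a neighbouring backbone vertex as soon as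
  \<open>k \<ge> 2\<close>.\<close>

lemma dominable_exceptI:
  assumes F: "F_presentation V E k v S" and i: "i < k"
    and le: "a \<le> 4" "b \<le> 4" "c \<le> 4" "d \<le> 4"
    and dom: "j = 1 \<or> a \<ge> 3 \<or> b = 4" "b \<ge> 3 \<or> a = 4 \<or> c = 4 \<or> k \<ge> 2"
      "j = 3 \<or> c \<ge> 3 \<or> b = 4 \<or> d = 4" "j = 4 \<or> d \<ge> 3 \<or> c = 4"
    and w: "7 * (k - 1) + a + b + c + d \<le> w"
  shows "dominable_except V E (v (i, j)) w"
proof -
  obtain h where h: "\<And>u. u \<in> V \<Longrightarrow> h u \<le> 4"
    "h (v (i, 1)) = a" "h (v (i, 2)) = b" "h (v (i, 3)) = c" "h (v (i, 4)) = d"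
    "sum h V = 7 * (k - 1) + a + b + c + d"
    "\<And>i' j. i' < k \<Longrightarrow> i' \<noteq> i \<Longrightarrow> j \<in> {1..4} \<Longrightarrow> dominated E h (v (i', j))"
    "k \<ge> 2 \<Longrightarrow> dominated E h (v (i, 2))"
    using F_presentation_override[OF F i le] by metis
  have own: "j = 1 \<or> dominated E h (v (i, 1))" "dominated E h (v (i, 2))"
    "j = 3 \<or> dominated E h (v (i, 3))" "j = 4 \<or> dominated E h (v (i, 4))"
    using dom[folded h(2-5)] h(8) dominated_self[of h _ E]
      F_presentation_edges[OF F i, THEN dominated_neighbour[where h = h]] by blast+
  have "u = v (i, j) \<or> dominated E h u" if uV: "u \<in> V" for u
  proof -
    obtain i' j' where u: "i' < k" "j' \<in> {1..4}" "u = v (i', j')"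
      using F_presentation_vertexE[OF F uV] .
    then have "j' = 1 \<or> j' = 2 \<or> j' = 3 \<or> j' = 4" by auto
    then show ?thesis using own u h(7)[OF u(1) _ u(2)] by (cases "i' = i") auto
  qed
  then show ?thesis unfolding dominable_except_def using h(1,6) w by (intro exI[of _ h]) auto
qed

text \<open>The cases record what a vertex can give and receive, compared with the weight
  \<open>7 * k\<close>. Position 3 counts as \<open>inner\<close> only for at least two paths; in a
  single path it becomes a backbone vertex by reversal.\<close>

lemma in_family_F_root_cases:
  assumes "in_family_F V E" "x \<in> V"
  obtains (backbone) k v S i where "F_presentation V E k v S" "i < k" "x = v (i, 2)"
      "card V = 4 * k" "heavy_at V E x (7 * k)"
  | (inner) k where "k \<ge> 1" "card V = 4 * k" "heavy_at V E x (7 * k)" "dominable_except V E x (7 * k - 1)"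
  | (leaf) k where "k \<ge> 1" "card V = 4 * k" "heavy_at V E x (7 * k + 1)" "dominable_except V E x (7 * k - 3)"
proof -
  obtain k v S where F: "F_presentation V E k v S" using assms(1) in_family_F_iff by blast
  have k: "k \<ge> 1" using F unfolding F_presentation_def by simp
  have card: "card V = 4 * k" using F_presentation_card[OF F] .
  obtain i j where ij: "i < k" "j \<in> {1..4}" "x = v (i, j)"
    using F_presentation_vertexE[OF F assms(2)] .
  then consider "j = 1" | "j = 2" | "j = 3" "k = 1" | "j = 3" "k \<ge> 2" | "j = 4"
    using k by fastforce
  then show ?thesis
  proof cases
    case 1
    \<comment> \<open>The labels 4, 0, 4, 0 weigh 8 instead of 7. Once \<open>v (i, 1)\<close> is
      dominated from outside, its label 4 is dropped and 4 remains.\<close>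
    have "heavy_at V E x (7 * k + 1)" unfolding ij(3)
      by (rule heavy_atI[OF F ij(1,2), of 4 0 4 0]) (use 1 k in auto)
    moreover have "dominable_except V E x (7 * k - 3)" unfolding ij(3)
      by (rule dominable_exceptI[OF F ij(1), of 0 0 4 0]) (use 1 k in auto)
    ultimately show ?thesis using leaf[OF k card] by blast
  next
    case 2
    have "heavy_at V E x (7 * k)" unfolding ij(3)
      by (rule heavy_atI[OF F ij(1,2), of 0 4 0 3]) (use 2 k in \<open>auto simp: numeral_eq_Suc\<close>)
    then show ?thesis using backbone[OF F ij(1)] card 2 ij by simp
  next
    case 3
    \<comment> \<open>The single path is presented anew in reverse order, with
      \<open>v (0, 3)\<close> in position 2.\<close>
    have i0: "i = 0" using 3 ij by simp
    have S: "S = {}" and V: "V = v ` ({..<1} \<times> {1..4})"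
      and E: "E = {{v (0, 1), v (0, 2)}, {v (0, 2), v (0, 3)}, {v (0, 3), v (0, 4)}} \<union> S"
      using F 3 unfolding F_presentation_def by auto
    have V': "V = {v (0, 4), v (0, 3), v (0, 2), v (0, 1)}"
      unfolding V atLeast1AtMost4 by auto
    have E': "E = {{v (0, 4), v (0, 3)}, {v (0, 3), v (0, 2)}, {v (0, 2), v (0, 1)}}"
      unfolding E S by (auto simp: insert_commute)
    have "distinct [v (0, 4), v (0, 3), v (0, 2), v (0, 1)]"
      using F_presentation_inj[OF F, of 0 0] 3 by simp
    then obtain v' where v': "F_presentation V E 1 v' {}" "v' (0, 2) = v (0, 3)"
      using P4_presentation unfolding V' E' by metis
    have "heavy_at V E (v' (0, 2)) 7"
      by (rule heavy_atI[OF v'(1), of 0 2 0 4 0 3]) (auto simp: numeral_eq_Suc)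
    then show ?thesis using backbone[OF v'(1), of 0] v'(2) card 3 ij i0 by simp
  next
    case 4
    have "heavy_at V E x (7 * k)" unfolding ij(3)
      by (rule heavy_atI[OF F ij(1,2), of 3 0 4 0]) (use 4 k in \<open>auto simp: numeral_eq_Suc\<close>)
    \<comment> \<open>The labels 3, 0, 0, 3 weigh 6: position 3 waits for help from outside, and
      position 2 gets it from another backbone vertex, by \<open>k \<ge> 2\<close>.\<close>
    moreover have "dominable_except V E x (7 * k - 1)" unfolding ij(3)
      by (rule dominable_exceptI[OF F ij(1), of 3 0 0 3]) (use 4 k in auto)
    ultimately show ?thesis using inner[OF k card] by blast
  next
    case 5
    have "heavy_at V E x (7 * k + 1)" unfolding ij(3)
      by (rule heavy_atI[OF F ij(1,2), of 0 4 0 4]) (use 5 k in \<open>auto simp: numeral_eq_Suc\<close>)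
    moreover have "dominable_except V E x (7 * k - 3)" unfolding ij(3)
      by (rule dominable_exceptI[OF F ij(1), of 0 4 0 0]) (use 5 k in auto)
    ultimately show ?thesis using leaf[OF k card] by blast
  qed
qed

section \<open>Joining two trees by an edge\<close>

text \<open>Help crosses the new edge in one direction only: \<open>x\<close> may rely on a label 4
  at \<open>y\<close>, while every other vertex is dominated on its own side. Without any reliance
  this is the plain juxtaposition of two labellings.\<close>

lemma glue_labellings:
  assumes sg: "simple_graph V1 E1" "simple_graph V2 E2" and disj: "V1 \<inter> V2 = {}"
    and sub: "E1 \<subseteq> E" "E2 \<subseteq> E" and xy: "{x, y} \<in> E" "y \<in> V2"
    and h1: "\<And>u. u \<in> V1 \<Longrightarrow> h1 u \<le> 4 \<and> (dominated E1 h1 u \<or> u = x \<and> h2 y = 4)"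
    and h2: "\<And>u. u \<in> V2 \<Longrightarrow> h2 u \<le> 4 \<and> dominated E2 h2 u"
  shows "dominable (V1 \<union> V2) E (sum h1 V1 + sum h2 V2)"
proof -
  define h where "h = (\<lambda>u. if u \<in> V1 then h1 u else h2 u)"
  have eq1: "h u = h1 u" if "u \<in> V1" for u using that unfolding h_def by simp
  have eq2: "h u = h2 u" if "u \<in> V2" for u using that disj unfolding h_def by auto
  have fin: "finite V1" "finite V2" using sg unfolding simple_graph_def by auto
  have "h u \<le> 4 \<and> dominated E h u" if "u \<in> V1 \<union> V2" for u
  proof (cases "u \<in> V1")
    case True
    have "dominated E h u"
    proof (cases "dominated E1 h1 u")
      case dom: True
      show ?thesis by (rule dominated_mono[OF sg(1) sub(1) True eq1 dom])
    next
      case False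
      then have "u = x" "h2 y = 4" using h1[OF True] by auto
      then show ?thesis using xy eq2 dominated_neighbour by metis
    qed
    then show ?thesis using h1[OF True] eq1[OF True] by simp
  next
    case False
    then have u: "u \<in> V2" using that by simp
    then have dom: "dominated E2 h2 u" using h2 by blast
    have "dominated E h u" by (rule dominated_mono[OF sg(2) sub(2) u eq2 dom])
    then show ?thesis using h2[OF u] eq2[OF u] by simp
  qed
  moreover have "sum h (V1 \<union> V2) = sum h1 V1 + sum h2 V2"
    using fin disj eq1 eq2 by (simp add: sum.union_disjoint)
  ultimately show ?thesis unfolding dominable_def by (intro exI[of _ h]) auto
qed

lemma dominable_union:
  assumes "simple_graph V1 E1" "simple_graph V2 E2" "V1 \<inter> V2 = {}"
    "E1 \<subseteq> E" "E2 \<subseteq> E" "{x, y} \<in> E" "y \<in> V2"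
    and d: "dominable V1 E1 w1" "dominable V2 E2 w2"
  shows "dominable (V1 \<union> V2) E (w1 + w2)"
proof -
  obtain h1 h2 where h: "\<forall>u\<in>V1. h1 u \<le> 4 \<and> dominated E1 h1 u" "sum h1 V1 \<le> w1"
    "\<forall>u\<in>V2. h2 u \<le> 4 \<and> dominated E2 h2 u" "sum h2 V2 \<le> w2"
    using d unfolding dominable_def by blast
  have "dominable (V1 \<union> V2) E (sum h1 V1 + sum h2 V2)"
    by (rule glue_labellings[OF assms(1-7)]) (use h in auto)
  then show ?thesis using h(2,4) unfolding dominable_def by (meson add_mono order_trans)
qed

lemma dominable_union_heavy:
  assumes "simple_graph V1 E1" "simple_graph V2 E2" "V1 \<inter> V2 = {}"
    "E1 \<subseteq> E" "E2 \<subseteq> E" "{x, y} \<in> E" "y \<in> V2"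
    and d: "dominable_except V1 E1 x w1" "heavy_at V2 E2 y w2"
  shows "dominable (V1 \<union> V2) E (w1 + w2)"
proof -
  obtain h1 h2 where h: "\<forall>u\<in>V1. h1 u \<le> 4 \<and> (u = x \<or> dominated E1 h1 u)" "sum h1 V1 \<le> w1"
    "\<forall>u\<in>V2. h2 u \<le> 4 \<and> dominated E2 h2 u" "sum h2 V2 \<le> w2" "h2 y = 4"
    using d unfolding dominable_except_def heavy_at_def by blast
  have "dominable (V1 \<union> V2) E (sum h1 V1 + sum h2 V2)"
    by (rule glue_labellings[OF assms(1-7)]) (use h in auto)
  then show ?thesis using h(2,4) unfolding dominable_def by (meson add_mono order_trans)
qed

text \<open>Nonempty edges over disjoint vertex sets are distinct, so that backbone edges of two
  members can be counted separately.\<close>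

lemma F_presentation_backbone:
  assumes F: "F_presentation V E k v S"
  shows "finite S" "\<And>e. e \<in> S \<Longrightarrow> e \<noteq> {} \<and> e \<subseteq> V"
proof -
  have S: "S \<subseteq> {{v (i, 2), v (j, 2)} | i j. i < k \<and> j < k \<and> i \<noteq> j}"
    using F unfolding F_presentation_def by simp
  have v2: "v (i, 2) \<in> V" if "i < k" for i
    using F_presentation_vertex[OF F that, of 2] by simp
  show sub: "e \<noteq> {} \<and> e \<subseteq> V" if "e \<in> S" for e using S that v2 by blast
  have "finite V" using F unfolding F_presentation_def by simp
  then show "finite S" using sub by (meson PowI finite_Pow_iff finite_subset subsetI)
qed

text \<open>The paths of the second member are renumbered from \<open>k1\<close> on, and the new
  edge joins the two backbones into one.\<close>

lemma F_presentation_join: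
  assumes F1: "F_presentation V1 E1 k1 v1 S1" and F2: "F_presentation V2 E2 k2 v2 S2"
    and disj: "V1 \<inter> V2 = {}" and i1: "i1 < k1" and i2: "i2 < k2"
  shows "in_family_F (V1 \<union> V2) (insert {v1 (i1, 2), v2 (i2, 2)} (E1 \<union> E2))"
proof -
  define v where "v = (\<lambda>(i, j). if i < k1 then v1 (i, j) else v2 (i - k1, j))"
  let ?x = "v1 (i1, 2)" and ?y = "v2 (i2, 2)"
  define S where "S = insert {?x, ?y} (S1 \<union> S2)"
  have lo: "v (i, j) = v1 (i, j)" if "i < k1" for i j using that unfolding v_def by simp
  have hi: "v (k1 + i, j) = v2 (i, j)" for i j unfolding v_def by simp
  have split: "(\<exists>i<k1 + k2. P i) \<longleftrightarrow> (\<exists>i<k1. P i) \<or> (\<exists>i<k2. P (k1 + i))" for P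
    by (metis add_less_cancel_left less_add_eq_less le_add_diff_inverse not_less trans_less_add1)
  have Uni: "(\<Union>i<k1 + k2. A i) = (\<Union>i<k1. A i) \<union> (\<Union>i<k2. A (k1 + i))" for A :: "nat \<Rightarrow> 'b set"
    using split[of "\<lambda>i. _ \<in> A i"] by (simp add: set_eq_iff Bex_def)
  have img: "v ` ({..<k1 + k2} \<times> J) = v1 ` ({..<k1} \<times> J) \<union> v2 ` ({..<k2} \<times> J)" for J
  proof -
    have "v ` ({..<k1 + k2} \<times> J) = (\<Union>i<k1 + k2. (\<lambda>j. v (i, j)) ` J)" by auto
    also have "\<dots> = (\<Union>i<k1. (\<lambda>j. v1 (i, j)) ` J) \<union> (\<Union>i<k2. (\<lambda>j. v2 (i, j)) ` J)"
      unfolding Uni hi using lo by simp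
    also have "\<dots> = v1 ` ({..<k1} \<times> J) \<union> v2 ` ({..<k2} \<times> J)" by auto
    finally show ?thesis .
  qed
  have k: "k1 \<ge> 1" "k2 \<ge> 1" using F1 F2 unfolding F_presentation_def by auto
  have V: "V1 = v1 ` ({..<k1} \<times> {1..4})" "V2 = v2 ` ({..<k2} \<times> {1..4})"
    using F1 F2 unfolding F_presentation_def by auto
  have xV: "?x \<in> V1" and yV: "?y \<in> V2"
    using F_presentation_vertex[OF F1 i1, of 2] F_presentation_vertex[OF F2 i2, of 2] by auto
  have cVs: "card V1 = 4 * k1" "card V2 = 4 * k2"
    using F_presentation_card[OF F1] F_presentation_card[OF F2] by auto
  have fV: "finite V1" "finite V2" unfolding V by auto
  have Veq: "V1 \<union> V2 = v ` ({..<k1 + k2} \<times> {1..4})" unfolding img V ..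
  \<comment> \<open>Injectivity follows by counting: the image has \<open>4 * k1 + 4 * k2\<close>
    elements, as many as the index set.\<close>
  have "card (v ` ({..<k1 + k2} \<times> {1..4})) = card ({..<k1 + k2} \<times> {1..4::nat})"
    unfolding Veq[symmetric] using cVs fV disj by (simp add: card_Un_disjoint card_cartesian_product)
  then have inj: "inj_on v ({..<k1 + k2} \<times> {1..4})"
    by (intro eq_card_imp_inj_on) auto
  note b1 = F_presentation_backbone[OF F1] and b2 = F_presentation_backbone[OF F2]
  have "S1 \<inter> S2 = {}" using b1(2) b2(2) disj by blast
  moreover have "{?x, ?y} \<notin> S1 \<union> S2" using b1(2) b2(2) disj xV yV by blast
  moreover have "card S1 = k1 - 1" "card S2 = k2 - 1"
    using F1 F2 unfolding F_presentation_def by auto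
  \<comment> \<open>\<open>(k1 - 1) + (k2 - 1)\<close> old backbone edges and the new one.\<close>
  ultimately have cS: "card S = k1 + k2 - 1"
    unfolding S_def using b1(1) b2(1) k by (simp add: card_Un_disjoint)
  have S: "e \<in> {{v (i, 2), v (j, 2)} | i j. i < k1 + k2 \<and> j < k1 + k2 \<and> i \<noteq> j}" if e: "e \<in> S" for e
  proof -
    from e consider "e = {?x, ?y}" | "e \<in> S1" | "e \<in> S2" unfolding S_def by blast
    then have "\<exists>i j. e = {v (i, 2), v (j, 2)} \<and> i < k1 + k2 \<and> j < k1 + k2 \<and> i \<noteq> j"
    proof cases
      case 1
      then show ?thesis using i1 i2 lo hi by (intro exI[of _ i1] exI[of _ "k1 + i2"]) auto
    next
      case 2
      then obtain i j where "e = {v1 (i, 2), v1 (j, 2)}" "i < k1" "j < k1" "i \<noteq> j"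
        using F1 unfolding F_presentation_def by blast
      then show ?thesis using lo by (intro exI[of _ i] exI[of _ j]) auto
    next
      case 3
      then obtain i j where "e = {v2 (i, 2), v2 (j, 2)}" "i < k2" "j < k2" "i \<noteq> j"
        using F2 unfolding F_presentation_def by blast
      then show ?thesis using hi by (intro exI[of _ "k1 + i"] exI[of _ "k1 + j"]) auto
    qed
    then show ?thesis by simp
  qed
  have reach: "(?x, u) \<in> (adj_rel S)\<^sup>*" if u: "u \<in> v ` ({..<k1 + k2} \<times> {2})" for u
  proof -
    from u consider "u \<in> v1 ` ({..<k1} \<times> {2})" | "u \<in> v2 ` ({..<k2} \<times> {2})"
      unfolding img by blast
    then show ?thesis
    proof cases
      case 1
      then have "(?x, u) \<in> (adj_rel S1)\<^sup>*"
        using F1 i1 unfolding F_presentation_def connected_graph_def by blast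
      then show ?thesis by (rule rtrancl_adj_rel_mono) (auto simp: S_def)
    next
      case 2
      then have "(?y, u) \<in> (adj_rel S2)\<^sup>*"
        using F2 i2 unfolding F_presentation_def connected_graph_def by blast
      then have "(?y, u) \<in> (adj_rel S)\<^sup>*" by (rule rtrancl_adj_rel_mono) (auto simp: S_def)
      moreover have "(?x, ?y) \<in> adj_rel S" unfolding S_def adj_rel_def by simp
      ultimately show ?thesis by (rule converse_rtrancl_into_rtrancl[rotated])
    qed
  qed
  have conn: "connected_graph (v ` ({..<k1 + k2} \<times> {2})) S"
    unfolding connected_graph_def
    by (intro ballI) (rule rtrancl_trans[OF rtrancl_adj_rel_sym[OF reach] reach])
  have E: "insert {?x, ?y} (E1 \<union> E2) =
      (\<Union>i<k1 + k2. {{v (i, 1), v (i, 2)}, {v (i, 2), v (i, 3)}, {v (i, 3), v (i, 4)}}) \<union> S"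
  proof -
    have E1: "E1 = (\<Union>i<k1. {{v1 (i, 1), v1 (i, 2)}, {v1 (i, 2), v1 (i, 3)}, {v1 (i, 3), v1 (i, 4)}}) \<union> S1"
      using F1 unfolding F_presentation_def by simp
    have E2: "E2 = (\<Union>i<k2. {{v2 (i, 1), v2 (i, 2)}, {v2 (i, 2), v2 (i, 3)}, {v2 (i, 3), v2 (i, 4)}}) \<union> S2"
      using F2 unfolding F_presentation_def by simp
    have "(\<Union>i<k1. {{v (i, 1), v (i, 2)}, {v (i, 2), v (i, 3)}, {v (i, 3), v (i, 4)}}) =
        (\<Union>i<k1. {{v1 (i, 1), v1 (i, 2)}, {v1 (i, 2), v1 (i, 3)}, {v1 (i, 3), v1 (i, 4)}})"
      using lo by (intro SUP_cong) auto
    moreover have "insert e ((P \<union> A) \<union> (Q \<union> B)) = (P \<union> Q) \<union> insert e (A \<union> B)"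
      for e and P A Q B :: "'a set set" by blast
    ultimately show ?thesis unfolding Uni hi E1 E2 S_def by simp
  qed
  have "F_presentation (V1 \<union> V2) (insert {?x, ?y} (E1 \<union> E2)) (k1 + k2) v S"
    unfolding F_presentation_def
  proof (intro conjI)
    show "S \<subseteq> {{v (i, 2), v (j, 2)} | i j. i < k1 + k2 \<and> j < k1 + k2 \<and> i \<noteq> j}" using S by (rule subsetI)
    show "k1 + k2 \<ge> 1" using k by simp
  qed (fact inj Veq cS conn E)+
  then show ?thesis unfolding in_family_F_iff by blast
qed

lemma dominable_if_heavy_at: "heavy_at V E x w \<Longrightarrow> dominable V E w"
  unfolding heavy_at_def dominable_def by blast

lemma F_presentation_dominable:
  assumes "F_presentation V E k v S"
  shows "dominable V E (7 * k)"
proof -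
  have k: "0 < k" using assms unfolding F_presentation_def by simp
  have "heavy_at V E (v (0, 2)) (7 * k)"
    by (rule heavy_atI[OF assms k, of 2 0 4 0 3]) (use k in \<open>auto simp: numeral_eq_Suc\<close>)
  then show ?thesis by (rule dominable_if_heavy_at)
qed

text \<open>Unless both ends are backbone vertices, the direction of help is chosen so that the
  saving of the receiving side exceeds the surcharge of the giving side: \<open>light\<close> helps
  \<open>x\<close> and \<open>light'\<close> helps \<open>y\<close>.\<close>

lemma join_in_family_F:
  assumes sg: "simple_graph V1 E1" "simple_graph V2 E2" and disj: "V1 \<inter> V2 = {}"
    and xy: "x \<in> V1" "y \<in> V2" and F: "in_family_F V1 E1" "in_family_F V2 E2"
    and E: "E = insert {x, y} (E1 \<union> E2)"
  shows "(\<exists>w. dominable (V1 \<union> V2) E w \<and> 4 * w < 7 * card (V1 \<union> V2)) \<or> in_family_F (V1 \<union> V2) E"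
proof -
  have card: "card (V1 \<union> V2) = card V1 + card V2"
    using sg disj unfolding simple_graph_def by (simp add: card_Un_disjoint)
  have light: ?thesis if "dominable_except V1 E1 x w1" "heavy_at V2 E2 y w2"
    "4 * (w1 + w2) < 7 * (card V1 + card V2)" for w1 w2
  proof -
    have "dominable (V1 \<union> V2) E (w1 + w2)"
      by (rule dominable_union_heavy[OF sg disj _ _ _ xy(2) that(1,2)]) (auto simp: E)
    then show ?thesis using that(3) card by metis
  qed
  have light': ?thesis if "heavy_at V1 E1 x w1" "dominable_except V2 E2 y w2"
    "4 * (w1 + w2) < 7 * (card V1 + card V2)" for w1 w2
  proof -
    have "dominable (V2 \<union> V1) E (w2 + w1)"
      by (rule dominable_union_heavy[OF sg(2,1) _ _ _ _ xy(1) that(2,1)]) (use disj in \<open>auto simp: E insert_commute\<close>)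
    then show ?thesis using that(3) card by (metis Un_commute add.commute)
  qed
  show ?thesis
    using F(1) xy(1)
  proof (cases rule: in_family_F_root_cases)
    case 1: (backbone k1 v1 S1 i1)
    show ?thesis
      using F(2) xy(2)
    proof (cases rule: in_family_F_root_cases)
      case 2: (backbone k2 v2 S2 i2)
      show ?thesis using F_presentation_join[OF 1(1) 2(1) disj 1(2) 2(2)] 1 2 E by simp
    next
      case 2: (inner k2)
      show ?thesis by (rule light'[OF 1(5) 2(4)]) (use 1 2 in auto)
    next
      case 2: (leaf k2)
      show ?thesis by (rule light'[OF 1(5) 2(4)]) (use 1 2 in auto)
    qed
  next
    case 1: (inner k1)
    show ?thesis
      using F(2) xy(2)
    proof (cases rule: in_family_F_root_cases)
      case 2: (backbone k2 v2 S2 i2)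
      show ?thesis by (rule light[OF 1(4) 2(5)]) (use 1 2 in auto)
    next
      case 2: (inner k2)
      show ?thesis by (rule light[OF 1(4) 2(3)]) (use 1 2 in auto)
    next
      case 2: (leaf k2)
      \<comment> \<open>The leaf has to receive: the opposite direction would save 1 and cost
        1.\<close>
      show ?thesis by (rule light'[OF 1(3) 2(4)]) (use 1 2 in auto)
    qed
  next
    case 1: (leaf k1)
    show ?thesis
      using F(2) xy(2)
    proof (cases rule: in_family_F_root_cases)
      case 2: (backbone k2 v2 S2 i2)
      show ?thesis by (rule light[OF 1(4) 2(5)]) (use 1 2 in auto)
    next
      case 2: (inner k2)
      show ?thesis by (rule light[OF 1(4) 2(3)]) (use 1 2 in auto)
    next
      case 2: (leaf k2)
      show ?thesis by (rule light[OF 1(4) 2(3)]) (use 1 2 in auto)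
    qed
  qed
qed

section \<open>The dichotomy for all trees, by induction on the order\<close>

lemma tree_dominable_or_in_family_F:
  assumes "is_tree V E" "card V \<ge> 3"
  shows "(\<exists>w. dominable V E w \<and> 4 * w < 7 * card V) \<or> in_family_F V E"
  using assms
proof (induction "card V" arbitrary: V E rule: less_induct)
  case less
  have sg: "simple_graph V E" using less(2) unfolding is_tree_def by simp
  show ?case
  proof (cases "\<forall>x y. {x, y} \<in> E \<longrightarrow> card (side E x y) \<le> 2 \<or> card (side E y x) \<le> 2")
    case True
    then obtain c where "c \<in> V" "\<And>y. {c, y} \<in> E \<Longrightarrow> card (side E c y) \<le> 2"
      using exists_center[OF less(2)] by blast
    then show ?thesis using spider_dominable_or_in_family_F[OF less(2) _ less(3)] by blast
  next
    case False
    then obtain x y where xy: "{x, y} \<in> E" "\<not> card (side E x y) \<le> 2" "\<not> card (side E y x) \<le> 2"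
      by blast
    have yx: "{y, x} \<in> E" using xy(1) by (simp add: insert_commute)
    \<comment> \<open>\<open>side\<close> takes its root as second argument, so \<open>V1\<close> is
      the part of \<open>x\<close> and \<open>V2\<close> the part of \<open>y\<close>.\<close>
    define V1 V2 where "V1 = side E y x" and "V2 = side E x y"
    define E1 E2 where "E1 = {f \<in> E. f \<subseteq> V1}" and "E2 = {f \<in> E. f \<subseteq> V2}"
    have trees: "is_tree V1 E1" "is_tree V2 E2"
      unfolding V1_def V2_def E1_def E2_def
      using side_is_tree[OF less(2) yx] side_is_tree[OF less(2) xy(1)] by auto
    then have sgs: "simple_graph V1 E1" "simple_graph V2 E2" unfolding is_tree_def by auto
    have disj: "V1 \<inter> V2 = {}" unfolding V1_def V2_def using sides_disjoint[OF less(2) yx] .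
    have V: "V = V1 \<union> V2" unfolding V1_def V2_def using sides_cover[OF less(2) yx] .
    have E: "E = insert {x, y} (E1 \<union> E2)"
      using edges_split[OF less(2) xy(1)] unfolding V1_def V2_def E1_def E2_def by blast
    have xV: "x \<in> V1" and yV: "y \<in> V2" unfolding V1_def V2_def by (rule root_in_side)+
    have ge: "card V1 \<ge> 3" "card V2 \<ge> 3" using xy unfolding V1_def V2_def by auto
    have card: "card V = card V1 + card V2"
      unfolding V using sgs disj unfolding simple_graph_def by (simp add: card_Un_disjoint)
    have IH1: "(\<exists>w. dominable V1 E1 w \<and> 4 * w < 7 * card V1) \<or> in_family_F V1 E1"
      using less(1)[OF _ trees(1) ge(1)] card ge by simp
    have IH2: "(\<exists>w. dominable V2 E2 w \<and> 4 * w < 7 * card V2) \<or> in_family_F V2 E2"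
      using less(1)[OF _ trees(2) ge(2)] card ge by simp
    \<comment> \<open>Members of the family still meet the bound non-strictly, so strictness on one
      of the two sides is enough for the sum.\<close>
    have weak: "\<exists>w. dominable V' E' w \<and> 4 * w \<le> 7 * card V'" if F': "in_family_F V' E'"
      for V' :: "'a set" and E'
    proof -
      obtain k v S where F: "F_presentation V' E' k v S" using F' in_family_F_iff by blast
      show ?thesis using F_presentation_dominable[OF F] F_presentation_card[OF F] by auto
    qed
    have glue: ?thesis if "dominable V1 E1 w1" "dominable V2 E2 w2" "4 * (w1 + w2) < 7 * card V"
      for w1 w2
    proof -
      have "dominable (V1 \<union> V2) E (w1 + w2)"
        by (rule dominable_union[OF sgs disj _ _ xy(1) yV that(1,2)]) (auto simp: E)
      then show ?thesis using that(3) V by metis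
    qed
    show ?thesis
    proof (cases "in_family_F V1 E1 \<and> in_family_F V2 E2")
      case True
      then show ?thesis using join_in_family_F[OF sgs disj xV yV _ _ E] V by simp
    next
      case False
      then obtain w1 w2 where "dominable V1 E1 w1" "dominable V2 E2 w2"
        "4 * w1 \<le> 7 * card V1" "4 * w2 \<le> 7 * card V2" "4 * w1 < 7 * card V1 \<or> 4 * w2 < 7 * card V2"
        using IH1 IH2 weak[of V1 E1] weak[of V2 E2] by (metis order_less_imp_le)
      then show ?thesis using card by (intro glue[of w1 w2]) auto
    qed
  qed
qed

section \<open>The lower bound for members of the family\<close>

text \<open>Enlarging the active neighbourhood to \<open>W\<close> can only increase the sum of
  excesses. A concrete \<open>W\<close> inside one path thus yields an inequality about the labels
  of that path alone.\<close>

lemma is_3RDF_excess: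
  assumes "simple_graph V E" "is_3RDF V E h" "u \<in> V" "h u < 3" "nbhd E u \<subseteq> W" "finite W"
  shows "3 \<le> h u + (\<Sum>w\<in>W. h w - 1)"
proof -
  have AN: "AN E h u \<subseteq> W" using assms(5) unfolding AN_def by blast
  then have fin: "finite (AN E h u)" using assms(6) finite_subset by blast
  have nin: "u \<notin> AN E h u"
    using simple_graph_edge(3)[OF assms(1)] unfolding AN_def nbhd_def by blast
  have "sum h (AN E h u) = card (AN E h u) + (\<Sum>w\<in>AN E h u. h w - 1)"
    by (rule sum_eq_card_plus_excess) (simp add: AN_def)
  then have "sum h (AN E h u) \<le> card (AN E h u) + (\<Sum>w\<in>W. h w - 1)"
    using sum_mono2[OF assms(6) AN, of "\<lambda>w. h w - 1"] by simp
  moreover have "card (AN E h u) + 3 \<le> h u + sum h (AN E h u)"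
    using assms(2-4) fin nin unfolding is_3RDF_def ANc_def by fastforce
  ultimately show ?thesis by linarith
qed

text \<open>The additional edges touch backbone vertices only, so the neighbours of the other three
  vertices stay within their path.\<close>

lemma F_presentation_nbhd:
  assumes F: "F_presentation V E k v S" and i: "i < k"
  shows "nbhd E (v (i, 1)) \<subseteq> {v (i, 2)}" "nbhd E (v (i, 3)) \<subseteq> {v (i, 2), v (i, 4)}"
    "nbhd E (v (i, 4)) \<subseteq> {v (i, 3)}"
proof -
  have E: "E = (\<Union>i<k. {{v (i, 1), v (i, 2)}, {v (i, 2), v (i, 3)}, {v (i, 3), v (i, 4)}}) \<union> S"
    and S: "S \<subseteq> {{v (i, 2), v (j, 2)} | i j. i < k \<and> j < k \<and> i \<noteq> j}"
    using F unfolding F_presentation_def by auto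
  have cases: "\<exists>a<k. \<exists>b<k. {u, w} = {v (a, 1), v (a, 2)} \<or> {u, w} = {v (a, 2), v (a, 3)} \<or>
      {u, w} = {v (a, 3), v (a, 4)} \<or> {u, w} = {v (a, 2), v (b, 2)}"
    if uw: "{u, w} \<in> E" for u w
  proof (cases "{u, w} \<in> S")
    case True
    then obtain a b where "{u, w} = {v (a, 2), v (b, 2)}" "a < k" "b < k" using S by blast
    then show ?thesis by blast
  next
    case False
    then obtain a where "a < k"
      "{u, w} \<in> {{v (a, 1), v (a, 2)}, {v (a, 2), v (a, 3)}, {v (a, 3), v (a, 4)}}"
      using uw unfolding E by (elim UnE UN_E) auto
    then show ?thesis unfolding insert_iff empty_iff by blast
  qed
  note inj = F_presentation_inj[OF F]
  have "w = v (i, 2)" if "{v (i, 1), w} \<in> E" for w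
    using cases[OF that] i by (elim exE conjE) (auto simp: doubleton_eq_iff inj)
  then show "nbhd E (v (i, 1)) \<subseteq> {v (i, 2)}" unfolding nbhd_def by blast
  have "w = v (i, 2) \<or> w = v (i, 4)" if "{v (i, 3), w} \<in> E" for w
    using cases[OF that] i by (elim exE conjE) (auto simp: doubleton_eq_iff inj)
  then show "nbhd E (v (i, 3)) \<subseteq> {v (i, 2), v (i, 4)}" unfolding nbhd_def by blast
  have "w = v (i, 3)" if "{v (i, 4), w} \<in> E" for w
    using cases[OF that] i by (elim exE conjE) (auto simp: doubleton_eq_iff inj)
  then show "nbhd E (v (i, 4)) \<subseteq> {v (i, 3)}" unfolding nbhd_def by blast
qed

lemma F_presentation_weight_ge:
  assumes sg: "simple_graph V E" and F: "F_presentation V E k v S" and h: "is_3RDF V E h"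
  shows "7 * k \<le> sum h V"
proof -
  have "7 \<le> h (v (i, 1)) + h (v (i, 2)) + h (v (i, 3)) + h (v (i, 4))" if i: "i < k" for i
  proof -
    note N = F_presentation_nbhd[OF F i]
    have V: "v (i, 1) \<in> V" "v (i, 3) \<in> V" "v (i, 4) \<in> V"
      using F_presentation_vertex[OF F i] by auto
    have ne: "v (i, 2) \<noteq> v (i, 4)" using F_presentation_inj[OF F i i, of 2 4] by simp
    have "h (v (i, 1)) \<ge> 3 \<or> 3 \<le> h (v (i, 1)) + (h (v (i, 2)) - 1)"
      using is_3RDF_excess[OF sg h V(1) _ N(1)] by fastforce
    moreover have "h (v (i, 3)) \<ge> 3 \<or> 3 \<le> h (v (i, 3)) + ((h (v (i, 2)) - 1) + (h (v (i, 4)) - 1))"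
      using is_3RDF_excess[OF sg h V(2) _ N(2)] ne by fastforce
    moreover have "h (v (i, 4)) \<ge> 3 \<or> 3 \<le> h (v (i, 4)) + (h (v (i, 3)) - 1)"
      using is_3RDF_excess[OF sg h V(3) _ N(3)] by fastforce
    \<comment> \<open>The first two labels sum to at least 3, with equality only for 3, 0; the last
      two likewise, with equality only for 0, 3. Both equalities at once would leave
      \<open>v (i, 3)\<close> with total excess 2, so the sum is at least 7.\<close>
    ultimately show ?thesis by arith
  qed
  then have "(\<Sum>i<k. 7) \<le> (\<Sum>i<k. h (v (i, 1)) + h (v (i, 2)) + h (v (i, 3)) + h (v (i, 4)))"
    by (intro sum_mono) auto
  then show ?thesis unfolding F_presentation_sum[OF F] by simp
qed

section \<open>The characterization of equality\<close>

lemma gamma3R_attained: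
  assumes "is_3RDF V E h"
  shows "\<exists>h. is_3RDF V E h \<and> gamma3R V E = sum h V"
  unfolding gamma3R_def by (rule LeastI[of _ "sum h V"]) (use assms in blast)

theorem theorem14:
  fixes V :: "'a set" and E :: "'a set set"
  assumes "is_tree V E" and "card V \<ge> 3"
  shows "real (gamma3R V E) = 7 * real (card V) / 4 \<longleftrightarrow> in_family_F V E"
proof
  have sg: "simple_graph V E" using assms unfolding is_tree_def by simp
  {
    assume eq: "real (gamma3R V E) = 7 * real (card V) / 4"
    \<comment> \<open>Equality forbids any lighter labelling, which rules out the first alternative
      of the dichotomy.\<close>
    have "\<not> 4 * w < 7 * card V" if "dominable V E w" for w
      using gamma3R_le_if_dominable[OF sg that] eq by linarith
    then show "in_family_F V E" using tree_dominable_or_in_family_F[OF assms] by blast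
  next
    assume "in_family_F V E"
    then obtain k v S where F: "F_presentation V E k v S" unfolding in_family_F_iff by blast
    have "gamma3R V E \<le> 7 * k"
      using gamma3R_le_if_dominable[OF sg F_presentation_dominable[OF F]] .
    \<comment> \<open>The constant labelling shows that some 3RDF exists, so the
      \<open>LEAST\<close> in \<open>gamma3R\<close> is attained and the lower bound applies to a
      minimizer.\<close>
    moreover have "is_3RDF V E (\<lambda>_. 3)"
      using sg by (intro is_3RDF_if_dominated) (auto intro: dominated_self)
    then obtain h where "is_3RDF V E h" "gamma3R V E = sum h V"
      using gamma3R_attained by blast
    then have "7 * k \<le> gamma3R V E" using F_presentation_weight_ge[OF sg F] by simp
    ultimately show "real (gamma3R V E) = 7 * real (card V) / 4"
      using F_presentation_card[OF F] by simp
  }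
qed

end
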